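(* Let $T\in\mathcal{BC}^{0,1}(V_5)$. For all $p,s\in\rho_S(T)$ with $s\notin[p]$, the following equation holds: \begin{align*} &S_{D,R}^{-1}(s,T)\,S_{L}^{-1}(p,T)+S_{R}^{-1}(s,\overline{T})\,S_{D,L}^{-1}(p,T)\\ &\quad=\Big[\big(S^{-1}_{D,L}(s,T)-S^{-1}_{D,L}(p,T)\big)p-\bar{s}\big(S^{-1}_{D,L}(s,T)-S^{-1}_{D,L}(p,T)\big)\Big]\,Q_s^{-1}(p). \end{align*}
   Context: $\mathbb{R}_5$ is the real Clifford algebra with imaginary units $e_1,\dots,e_5$, $e_\ell e_m+e_me_\ell=0$ for $\ell\ne m$, $e_\ell^2=-1$. A point of $\mathbb{R}^{6}$ is identified with the paravector $x=x_0+\underline{x}=x_0+\sum_{j=1}^5x_je_j\in\mathbb{R}_5$; $\bar x=x_0-\underline{x}$, $|x|^2=\sum_{j=0}^5x_j^2$, $\mathrm{Re}(x)=x_0$. $\mathbb{S}=\{\underline{x}:\ x_1^2+\dots+x_5^2=1\}$ and $[x]=\{\mathrm{Re}(x)+I|\underline{x}|:\ I\in\mathbb{S}\}$. $V$ is a real Banach space, $V_5=V\otimes\mathbb{R}_5$ the associated two-sided Clifford Banach module, $\mathcal{B}(V_5)$ the bounded right-linear operators on $V_5$. Elements $a\in\mathbb{R}_5$ act on $V_5$ by left multiplication, and products such as $aT$, $Ta$ are compositions of operators. $\mathcal{BC}^{0,1}(V_5)$ is the set of operators $T=T_0+\sum_{j=1}^5e_jT_j$ whose components $T_0,\dots,T_5$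 are bounded operators on $V$ that commute pairwise. For such $T$, $\overline{T}=T_0-\sum_{j=1}^5e_jT_j$. For $T\in\mathcal{BC}^{0,1}(V_5)$ the $S$-spectrum is $\sigma_S(T)=\{s\in\mathbb{R}^6: T^2-2\mathrm{Re}(s)T+|s|^2\mathcal{I}\text{ is not invertible in }\mathcal{B}(V_5)\}$; it is known to coincide with the set of $s\in\mathbb{R}^6$ for which $s^2\mathcal{I}-s(T+\overline{T})+T\overline{T}$ is not invertible. $\rho_S(T)=\mathbb{R}^6\setminus\sigma_S(T)$. For $s\in\rho_S(T)$: $$\mathcal{Q}_{c,s}^{-1}(T)=(s^2\mathcal{I}-s(T+\overline{T})+T\overline{T})^{-1},\quad S_L^{-1}(s,T)=(s\mathcal{I}-\overline{T})\mathcal{Q}_{c,s}^{-1}(T),\quad S_R^{-1}(s,T)=\mathcal{Q}_{c,s}^{-1}(T)(s\mathcal{I}-\overline{T}).$$ Since $\mathcal{Q}_{c,s}^{-1}(\overline T)=\mathcal{Q}_{c,s}^{-1}(T)$, one has $S_R^{-1}(s,\overline{T})=\mathcal{Q}_{c,s}^{-1}(T)(s\mathcal{I}-T)$. The bi-harmonic resolvent operators are $S_{D,L}^{-1}(s,T)=S_{D,R}^{-1}(s,T)=-4\mathcal{Q}_{c,s}^{-1}(T)$. Finally $Q_s(p)=p^2-2s_0p+|s|^2$ with $s_0=\mathrm{Re}(s)$, and $Q_s^{-1}(p)=Q_s(p)^{-1}$. *)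

theory Defs
  imports "HOL-Analysis.Analysis"
begin

section \<open>The Clifford algebra with five imaginary units\<close>

text \<open>
  The imaginary units are indexed by the five-element linear order \<^typ>\<open>5\<close> (residues mod 5). The basis element \<open>e\<^sub>A\<close> is the
  product of the units \<open>e\<^sub>a\<close>, \<open>a \<in> A\<close>, in increasing order of the indices. Then
  \<open>e\<^sub>A e\<^sub>B = \<plusminus> e\<^bsub>A \<triangle> B\<^esub>\<close>: sorting the product costs one sign for each pair \<open>b < a\<close> (anticommutation),
  and one more for each \<open>a = b\<close> (as \<open>e\<^sub>a\<^sup>2 = -1\<close>).
\<close>

definition blade_sign :: "5 set \<Rightarrow> 5 set \<Rightarrow> real" where
  "blade_sign A B = (-1) ^ card {(a, b). a \<in> A \<and> b \<in> B \<and> b \<le> a}"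

text \<open>
  An element of \<open>W \<otimes> \<real>\<^sub>5\<close> is given by its coefficients in \<open>W\<close> along the \<open>e\<^sub>A\<close>, that is by a vector
  indexed by the sets \<open>A\<close>. The following is \<open>(a \<otimes> e\<^sub>A) (b \<otimes> e\<^sub>B) = f a b \<otimes> e\<^sub>A e\<^sub>B\<close>, extended biadditively;
  it yields both the product of \<open>\<real>\<^sub>5\<close> and the two module structures on \<open>V\<^sub>5\<close>.
\<close>

definition blade_prod ::
  "('a \<Rightarrow> 'b \<Rightarrow> 'c::real_vector) \<Rightarrow> 'a ^ (5 set) \<Rightarrow> 'b ^ (5 set) \<Rightarrow> 'c ^ (5 set)" where
  "blade_prod f a b =
     (\<Sum>A\<in>UNIV. \<Sum>B\<in>UNIV. axis (sym_diff A B) (blade_sign A B *\<^sub>R f (a $ A) (b $ B)))"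

typedef clifford5 = "UNIV :: (real ^ (5 set)) set"
  morphisms coeffs Clifford5 ..

setup_lifting type_definition_clifford5

lemma blade_sign_prod: "blade_sign A B = (\<Prod>a\<in>A. \<Prod>b\<in>B. if b \<le> a then -1 else 1)"
proof -
  have "(\<Prod>a\<in>A. \<Prod>b\<in>B. if b \<le> a then -1 else (1::real))
      = (\<Prod>x\<in>A \<times> B. if snd x \<le> fst x then -1 else 1)"
    by (simp add: prod.cartesian_product case_prod_unfold)
  also have "\<dots> = (\<Prod>x\<in>{x\<in>A \<times> B. snd x \<le> fst x}. -1)"
    by (rule prod.inter_filter[symmetric]) (rule finite)
  also have "{x\<in>A \<times> B. snd x \<le> fst x} = {(a, b). a \<in> A \<and> b \<in> B \<and> b \<le> a}"
    by auto
  finally show ?thesis by (simp add: blade_sign_def)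
qed

lemma prod_sym_diff:
  fixes g :: "'i::finite \<Rightarrow> real"
  assumes "\<And>a. g a * g a = 1"
  shows "prod g (sym_diff A B) = prod g A * prod g B"
proof -
  have A: "prod g A = prod g (A - B) * prod g (A \<inter> B)"
    by (metis prod.Int_Diff finite mult.commute)
  have B: "prod g B = prod g (B - A) * prod g (A \<inter> B)"
    by (metis prod.Int_Diff finite mult.commute Int_commute)
  have sq: "prod g (A \<inter> B) * prod g (A \<inter> B) = 1"
    by (simp add: prod.distrib[symmetric] assms)
  have "prod g (sym_diff A B) = prod g (A - B) * prod g (B - A)"
    by (subst prod.union_disjoint) auto
  then show ?thesis using sq by (simp add: A B mult.assoc mult.left_commute)
qed

lemma blade_sign_sym_diff_left:
  "blade_sign (sym_diff A B) C = blade_sign A C * blade_sign B C"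
  unfolding blade_sign_prod by (rule prod_sym_diff) (auto simp: prod.distrib[symmetric] intro: prod.neutral)

lemma blade_sign_sym_diff_right:
  "blade_sign A (sym_diff B C) = blade_sign A B * blade_sign A C"
  unfolding blade_sign_prod
  by (subst prod_sym_diff) (auto simp: prod.distrib)

lemma blade_sign_empty [simp]: "blade_sign {} B = 1" "blade_sign A {} = 1"
  by (simp_all add: blade_sign_def)

lemma sym_diff_eq_iff: "sym_diff A B = C \<longleftrightarrow> B = sym_diff A C"
  by auto

lemma sym_diff_assoc: "sym_diff (sym_diff A B) C = sym_diff A (sym_diff B C)"
  by auto

lemma blade_prod_nth:
  "blade_prod f a b $ C
    = (\<Sum>A\<in>UNIV. blade_sign A (sym_diff A C) *\<^sub>R f (a $ A) (b $ sym_diff A C))"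
proof -
  have "(\<Sum>B\<in>UNIV. axis (sym_diff A B) (blade_sign A B *\<^sub>R f (a $ A) (b $ B)) $ C)
      = blade_sign A (sym_diff A C) *\<^sub>R f (a $ A) (b $ sym_diff A C)" for A
  proof -
    have "(\<Sum>B\<in>UNIV. axis (sym_diff A B) (blade_sign A B *\<^sub>R f (a $ A) (b $ B)) $ C)
        = (\<Sum>B\<in>UNIV. if B = sym_diff A C then blade_sign A B *\<^sub>R f (a $ A) (b $ B) else 0)"
      unfolding axis_def vec_lambda_beta
      by (intro sum.cong if_cong refl) (use sym_diff_eq_iff in metis)
    then show ?thesis by simp
  qed
  then show ?thesis by (simp add: blade_prod_def)
qed

lemma sum_reindex_sym_diff:
  fixes g :: "5 set \<Rightarrow> 'a::comm_monoid_add"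
  shows "(\<Sum>C\<in>UNIV. g C) = (\<Sum>B\<in>UNIV. g (sym_diff A B))"
  by (rule sum.reindex_bij_witness[where i = "sym_diff A" and j = "sym_diff A"]) (auto intro: arg_cong[where f=g])

lemma blade_prod_assoc:
  fixes f :: "'a \<Rightarrow> 'b::real_vector \<Rightarrow> 'c::real_vector"
    and g :: "'d \<Rightarrow> 'e \<Rightarrow> 'b" and h :: "'a \<Rightarrow> 'd \<Rightarrow> 'i::real_vector"
    and k :: "'i \<Rightarrow> 'e \<Rightarrow> 'c"
  assumes "\<And>x. linear (f x)" and "\<And>z. linear (\<lambda>y. k y z)"
    and "\<And>x y z. f x (g y z) = k (h x y) z"
  shows "blade_prod f a (blade_prod g b v) = blade_prod k (blade_prod h a b) v"
proof (subst vec_eq_iff, intro allI)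
  fix D
  let ?s = blade_sign
  have "blade_prod k (blade_prod h a b) v $ D =
     (\<Sum>C\<in>UNIV. \<Sum>A\<in>UNIV. (?s C (sym_diff C D) * ?s A (sym_diff A C)) *\<^sub>R
        k (h (a $ A) (b $ sym_diff A C)) (v $ sym_diff C D))"
    by (simp add: blade_prod_nth linear_sum[OF assms(2)] linear_scale[OF assms(2)] scaleR_sum_right)
  also have "\<dots> = (\<Sum>A\<in>UNIV. \<Sum>C\<in>UNIV. (?s C (sym_diff C D) * ?s A (sym_diff A C)) *\<^sub>R
        k (h (a $ A) (b $ sym_diff A C)) (v $ sym_diff C D))"
    by (rule sum.swap)
  also have "\<dots> = (\<Sum>A\<in>UNIV. \<Sum>B\<in>UNIV.
        (?s (sym_diff A B) (sym_diff (sym_diff A B) D) * ?s A (sym_diff A (sym_diff A B))) *\<^sub>R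
        k (h (a $ A) (b $ sym_diff A (sym_diff A B))) (v $ sym_diff (sym_diff A B) D))"
    by (intro sum.cong refl sum_reindex_sym_diff)
  also have "\<dots> = (\<Sum>A\<in>UNIV. \<Sum>B\<in>UNIV.
        (?s A (sym_diff A D) * ?s B (sym_diff B (sym_diff A D))) *\<^sub>R
        k (h (a $ A) (b $ B)) (v $ sym_diff B (sym_diff A D)))"
  proof (intro sum.cong refl)
    fix A B :: "5 set"
    have 1: "sym_diff A (sym_diff A B) = B" and
      2: "sym_diff (sym_diff A B) D = sym_diff B (sym_diff A D)" by auto
    have sq: "?s X Y * ?s X Y = 1" for X Y
      by (simp add: blade_sign_def power_mult_distrib[symmetric])
    have "?s (sym_diff A B) (sym_diff B (sym_diff A D)) * ?s A B
        = ?s A (sym_diff A D) * ?s B (sym_diff B (sym_diff A D)) * (?s A B * ?s A B)"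
      by (simp only: blade_sign_sym_diff_left blade_sign_sym_diff_right ac_simps)
    then show "(?s (sym_diff A B) (sym_diff (sym_diff A B) D) * ?s A (sym_diff A (sym_diff A B))) *\<^sub>R
        k (h (a $ A) (b $ sym_diff A (sym_diff A B))) (v $ sym_diff (sym_diff A B) D)
      = (?s A (sym_diff A D) * ?s B (sym_diff B (sym_diff A D))) *\<^sub>R
        k (h (a $ A) (b $ B)) (v $ sym_diff B (sym_diff A D))"
      unfolding 1 2 by (simp only: sq mult_1_right)
  qed
  also have "\<dots> = blade_prod f a (blade_prod g b v) $ D"
    by (simp add: blade_prod_nth linear_sum[OF assms(1)] linear_scale[OF assms(1)] scaleR_sum_right
        assms(3) mult.assoc)
  finally show "blade_prod f a (blade_prod g b v) $ D = blade_prod k (blade_prod h a b) v $ D" ..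
qed

instantiation clifford5 :: real_algebra_1
begin

lift_definition zero_clifford5 :: clifford5 is 0 .
lift_definition one_clifford5 :: clifford5 is "axis {} 1" .
lift_definition plus_clifford5 :: "clifford5 \<Rightarrow> clifford5 \<Rightarrow> clifford5" is "(+)" .
lift_definition minus_clifford5 :: "clifford5 \<Rightarrow> clifford5 \<Rightarrow> clifford5" is "(-)" .
lift_definition uminus_clifford5 :: "clifford5 \<Rightarrow> clifford5" is uminus .
lift_definition scaleR_clifford5 :: "real \<Rightarrow> clifford5 \<Rightarrow> clifford5" is "(*\<^sub>R)" .
lift_definition times_clifford5 :: "clifford5 \<Rightarrow> clifford5 \<Rightarrow> clifford5" is "blade_prod (*)" .

instance
proof
  fix a b c :: clifford5 and r t :: real
  show "a * b * c = a * (b * c)"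
    by transfer (rule blade_prod_assoc[symmetric];
        simp add: bounded_linear.linear bounded_linear_mult_left bounded_linear_mult_right)
  show "1 * a = a"
  proof (transfer, subst vec_eq_iff, intro allI)
    fix a :: "real ^ (5 set)" and C
    have "blade_prod (*) (axis {} 1) a $ C = (\<Sum>A\<in>(UNIV :: 5 set set). if A = {} then a $ C else 0)"
      unfolding blade_prod_nth by (rule sum.cong) (auto simp: axis_def)
    then show "blade_prod (*) (axis {} 1) a $ C = a $ C" by simp
  qed
  show "a * 1 = a"
  proof (transfer, subst vec_eq_iff, intro allI)
    fix a :: "real ^ (5 set)" and C
    have "blade_prod (*) a (axis {} 1) $ C = (\<Sum>A\<in>UNIV. if A = C then a $ C else 0)"
      unfolding blade_prod_nth by (rule sum.cong) (auto simp: axis_def)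
    then show "blade_prod (*) a (axis {} 1) $ C = a $ C" by simp
  qed
  show "(0::clifford5) \<noteq> 1" by transfer (metis axis_eq_0_iff zero_neq_one)
qed (transfer; simp add: vec_eq_iff blade_prod_nth algebra_simps sum.distrib sum_distrib_left)+

end

definition unit5 :: "5 \<Rightarrow> clifford5" where
  "unit5 j = Clifford5 (axis {j} 1)"

lemma blade_mult:
  "Clifford5 (axis A 1) * Clifford5 (axis B 1) = blade_sign A B *\<^sub>R Clifford5 (axis (sym_diff A B) 1)"
proof -
  have "blade_prod (*) (axis A 1) (axis B 1) $ C
      = (blade_sign A B *\<^sub>R axis (sym_diff A B) (1::real)) $ C" for C
  proof -
    have "blade_prod (*) (axis A 1) (axis B 1) $ C
      = (\<Sum>X\<in>UNIV. if X = A then blade_sign A (sym_diff A C) *\<^sub>R (axis B (1::real) $ sym_diff A C) else 0)"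
      unfolding blade_prod_nth by (rule sum.cong) (auto simp: axis_def)
    also have "\<dots> = blade_sign A (sym_diff A C) *\<^sub>R (axis B (1::real) $ sym_diff A C)" by simp
    also have "\<dots> = (blade_sign A B *\<^sub>R axis (sym_diff A B) (1::real)) $ C"
      using sym_diff_eq_iff[of A B C] by (auto simp: axis_def)
    finally show ?thesis .
  qed
  then have "blade_prod (*) (axis A 1) (axis B 1) = blade_sign A B *\<^sub>R axis (sym_diff A B) (1::real)"
    unfolding vec_eq_iff by blast
  then show ?thesis
    by (simp add: times_clifford5_def scaleR_clifford5_def Clifford5_inverse)
qed

lemma unit5_square: "unit5 j * unit5 j = -1"
proof -
  have "{(a, b). a \<in> {j} \<and> b \<in> {j} \<and> b \<le> a} = {(j, j)}" by auto
  then have "blade_sign {j} {j} = -1" by (simp add: blade_sign_def)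
  then show ?thesis by (simp add: unit5_def blade_mult one_clifford5_def)
qed

lemma unit5_anticommute:
  assumes "j \<noteq> k" shows "unit5 j * unit5 k + unit5 k * unit5 j = 0"
proof -
  have *: "blade_sign {a} {b} = (if b \<le> a then -1 else 1)" for a b
    by (simp add: blade_sign_prod)
  have "sym_diff {j} {k} = sym_diff {k} {j}" by auto
  then show ?thesis using assms
    by (auto simp: unit5_def blade_mult *)
qed

text \<open>Two-sided inverse; \<^typ>\<open>clifford5\<close> is not a division ring.\<close>

definition cl_inv :: "clifford5 \<Rightarrow> clifford5" where
  "cl_inv a = (THE b. a * b = 1 \<and> b * a = 1)"

section \<open>Paravectors\<close>

text \<open>
  A point of \<open>\<real>\<^sup>6\<close> is a pair \<open>(x\<^sub>0, x)\<close> with \<open>x \<in> \<real>\<^sup>5\<close>; the library norm of the pair is the Euclidean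
  one, and \<open>norm (snd x)\<close> is the modulus of the vector part.
\<close>

type_synonym R6 = "real \<times> (real ^ 5)"

definition paravec :: "R6 \<Rightarrow> clifford5" where
  "paravec x = of_real (fst x) + (\<Sum>j\<in>UNIV. (snd x $ j) *\<^sub>R unit5 j)"

definition pv_cnj :: "R6 \<Rightarrow> R6" where
  "pv_cnj x = (fst x, - snd x)"

definition pv_class :: "R6 \<Rightarrow> R6 set" where
  "pv_class x = {(fst x, norm (snd x) *\<^sub>R i) | i. norm i = 1}"

definition Qpoly :: "R6 \<Rightarrow> R6 \<Rightarrow> clifford5" where
  "Qpoly s p = paravec p ^ 2 - of_real (2 * fst s) * paravec p + of_real ((norm s)\<^sup>2)"

section \<open>Operators on the Clifford module\<close>

text \<open>
  The library norm on \<open>V\<^sub>5\<close> is \<open>(\<Sum>\<^sub>A \<parallel>v\<^sub>A\<parallel>\<^sup>2)\<^bsup>1/2\<^esup>\<close>; any of the usual choices gives the same bounded operators.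
\<close>

type_synonym 'v V5 = "'v ^ (5 set)"
type_synonym 'v op5 = "'v V5 \<Rightarrow>\<^sub>L 'v V5"

definition lact :: "clifford5 \<Rightarrow> 'v::real_vector V5 \<Rightarrow> 'v V5" where
  "lact a v = blade_prod (*\<^sub>R) (coeffs a) v"

definition ract :: "'v::real_vector V5 \<Rightarrow> clifford5 \<Rightarrow> 'v V5" where
  "ract v a = blade_prod (\<lambda>x r. r *\<^sub>R x) v (coeffs a)"

lemma bounded_linear_vecI:
  fixes f :: "'a::real_normed_vector \<Rightarrow> 'b::real_normed_vector ^ 'n"
  assumes "\<And>i. bounded_linear (\<lambda>x. f x $ i)"
  shows "bounded_linear f"
proof -
  have lin: "linear f"
    using linear_add[OF bounded_linear.linear[OF assms]] linear_scale[OF bounded_linear.linear[OF assms]]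
    by (intro linearI) (simp_all add: vec_eq_iff)
  obtain K where K: "\<And>i x. norm (f x $ i) \<le> norm x * K i"
    using bounded_linear.bounded[OF assms] by metis
  show ?thesis
  proof (rule bounded_linear_intro[where K = "\<Sum>i\<in>UNIV. K i"])
    fix x
    have "norm (f x) \<le> (\<Sum>i\<in>UNIV. norm (f x $ i))"
      unfolding norm_vec_def by (rule L2_set_le_sum) simp
    also have "\<dots> \<le> (\<Sum>i\<in>UNIV. norm x * K i)" by (rule sum_mono) (rule K)
    finally show "norm (f x) \<le> norm x * (\<Sum>i\<in>UNIV. K i)" by (simp add: sum_distrib_left)
  qed (simp_all add: lin linear_add linear_scale)
qed

lift_definition lmul :: "clifford5 \<Rightarrow> 'v::real_normed_vector op5" is lact
  unfolding lact_def
  by (rule bounded_linear_vecI, unfold blade_prod_nth)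
     (intro bounded_linear_sum bounded_linear_const_scaleR bounded_linear_vec_nth)

text \<open>An operator on \<open>V\<close> acts on \<open>V\<^sub>5\<close> coefficientwise.\<close>

lift_definition comp_op :: "('v::real_normed_vector \<Rightarrow>\<^sub>L 'v) \<Rightarrow> 'v op5" is
  "\<lambda>F v. \<chi> A. F (v $ A)"
  by (rule bounded_linear_vecI) (simp add: bounded_linear_compose[OF _ bounded_linear_vec_nth])

definition right_linear_ops :: "'v::real_normed_vector op5 set" where
  "right_linear_ops = {F. \<forall>v a. blinfun_apply F (ract v a) = ract (blinfun_apply F v) a}"

definition op_invertible :: "'v::real_normed_vector op5 \<Rightarrow> bool" where
  "op_invertible F \<longleftrightarrow> (\<exists>G\<in>right_linear_ops. F o\<^sub>L G = id_blinfun \<and> G o\<^sub>L F = id_blinfun)"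

definition op_inv :: "'v::real_normed_vector op5 \<Rightarrow> 'v op5" where
  "op_inv F = (THE G. G \<in> right_linear_ops \<and> F o\<^sub>L G = id_blinfun \<and> G o\<^sub>L F = id_blinfun)"

definition para_op :: "('v::real_normed_vector \<Rightarrow>\<^sub>L 'v) \<Rightarrow> (5 \<Rightarrow> ('v \<Rightarrow>\<^sub>L 'v)) \<Rightarrow> 'v op5" where
  "para_op T0 Ts = comp_op T0 + (\<Sum>j\<in>UNIV. lmul (unit5 j) o\<^sub>L comp_op (Ts j))"

definition BC01 :: "'v::real_normed_vector op5 set" where
  "BC01 = {para_op T0 Ts | T0 Ts.
     (\<forall>j. T0 o\<^sub>L Ts j = Ts j o\<^sub>L T0) \<and> (\<forall>j k. Ts j o\<^sub>L Ts k = Ts k o\<^sub>L Ts j)}"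

definition op_cnj :: "'v::real_normed_vector op5 \<Rightarrow> 'v op5" where
  "op_cnj T = (THE U. \<exists>T0 Ts. T = para_op T0 Ts \<and> U = para_op T0 (\<lambda>j. - Ts j))"

lemma para_op_axis:
  "blinfun_apply (para_op T0 Ts) (axis {} v) = axis {} (T0 v) + (\<Sum>j\<in>UNIV. axis {j} (Ts j v))"
proof -
  have 1: "blinfun_apply (comp_op F) (axis {} v) = axis {} (F v)" for F
    by (transfer) (auto simp: axis_def vec_eq_iff linear_simps)
  have 2: "blinfun_apply (lmul (unit5 j)) (axis {} w) = axis {j} w" for j and w :: 'a
  proof (transfer, subst vec_eq_iff, intro allI)
    fix j :: 5 and w :: 'a and C
    have "lact (unit5 j) (axis {} w) $ C
        = (\<Sum>A\<in>UNIV. if A = {j} then blade_sign A (sym_diff A C) *\<^sub>R (axis {} w $ sym_diff A C) else 0)"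
      unfolding lact_def blade_prod_nth unit5_def
      by (rule sum.cong) (auto simp: Clifford5_inverse axis_def)
    also have "\<dots> = blade_sign {j} (sym_diff {j} C) *\<^sub>R (axis {} w $ sym_diff {j} C)" by simp
    also have "\<dots> = axis {j} w $ C"
      using sym_diff_eq_iff[of "{j}" C "{}"] by (auto simp: axis_def)
    finally show "lact (unit5 j) (axis {} w) $ C = axis {j} w $ C" .
  qed
  show ?thesis by (simp add: para_op_def blinfun.add_left blinfun.sum_left 1 2)
qed

lemma para_op_inject:
  assumes "para_op T0 Ts = para_op U0 Us"
  shows "T0 = U0" "Ts = Us"
proof -
  have eq: "(axis {} (T0 v) + (\<Sum>j\<in>UNIV. axis {j} (Ts j v))) $ C
      = (axis {} (U0 v) + (\<Sum>j\<in>UNIV. axis {j} (Us j v))) $ C" for v C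
    using arg_cong[OF assms, of "\<lambda>T. blinfun_apply T (axis {} v)"] by (simp add: para_op_axis)
  show "T0 = U0"
  proof (rule blinfun_eqI)
    show "blinfun_apply T0 v = blinfun_apply U0 v" for v
      using eq[of v "{}"] by (simp add: axis_def)
  qed
  show "Ts = Us"
  proof (rule ext, rule blinfun_eqI)
    show "blinfun_apply (Ts k) v = blinfun_apply (Us k) v" for k v
      using eq[of v "{k}"] by (simp add: axis_def)
  qed
qed

lemma op_cnj_para_op: "op_cnj (para_op T0 Ts) = para_op T0 (\<lambda>j. - Ts j)"
  unfolding op_cnj_def
  by (rule the_equality) (auto dest: para_op_inject)

lemma lmul_mult: "lmul (a * b) = lmul a o\<^sub>L lmul b"
proof (rule blinfun_eqI)
  show "blinfun_apply (lmul (a * b)) v = blinfun_apply (lmul a o\<^sub>L lmul b) v" for v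
    by (simp add: lmul.rep_eq lact_def times_clifford5.rep_eq,
        rule blade_prod_assoc[symmetric])
       (auto intro!: linearI simp: scaleR_add_right scaleR_add_left)
qed

lemma lmul_right_linear: "lmul a \<in> right_linear_ops"
  by (auto simp: right_linear_ops_def lmul.rep_eq lact_def ract_def
      intro!: blade_prod_assoc linearI) (simp_all add: scaleR_add_right)

section \<open>Spectrum and resolvent operators\<close>

definition S_spectrum :: "'v::real_normed_vector op5 \<Rightarrow> R6 set" where
  "S_spectrum T =
     {s. \<not> op_invertible ((T o\<^sub>L T) - (2 * fst s) *\<^sub>R T + (norm s)\<^sup>2 *\<^sub>R id_blinfun)}"

definition S_resolvent_set :: "'v::real_normed_vector op5 \<Rightarrow> R6 set" where
  "S_resolvent_set T = - S_spectrum T"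

definition Qc_inv :: "R6 \<Rightarrow> 'v::real_normed_vector op5 \<Rightarrow> 'v op5" where
  "Qc_inv s T =
     op_inv (lmul (paravec s ^ 2) - (lmul (paravec s) o\<^sub>L (T + op_cnj T)) + (T o\<^sub>L op_cnj T))"

definition S_L_inv :: "R6 \<Rightarrow> 'v::real_normed_vector op5 \<Rightarrow> 'v op5" where
  "S_L_inv s T = (lmul (paravec s) - op_cnj T) o\<^sub>L Qc_inv s T"

definition S_R_inv :: "R6 \<Rightarrow> 'v::real_normed_vector op5 \<Rightarrow> 'v op5" where
  "S_R_inv s T = Qc_inv s T o\<^sub>L (lmul (paravec s) - op_cnj T)"

definition S_DL_inv :: "R6 \<Rightarrow> 'v::real_normed_vector op5 \<Rightarrow> 'v op5" where
  "S_DL_inv s T = (-4) *\<^sub>R Qc_inv s T"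

definition S_DR_inv :: "R6 \<Rightarrow> 'v::real_normed_vector op5 \<Rightarrow> 'v op5" where
  "S_DR_inv s T = (-4) *\<^sub>R Qc_inv s T"

end

theory Submission
  imports Defs
begin

text \<open>
  Write \<open>U = op_cnj T\<close>, \<open>A = T + U\<close> and \<open>B = T U\<close>. Since the components of \<open>T\<close> commute, \<open>A = 2 T\<^sub>0\<close> and
  \<open>B = T\<^sub>0\<^sup>2 + \<Sum>\<^sub>j T\<^sub>j\<^sup>2\<close> act coefficientwise on \<open>V\<^sub>5\<close>, so they commute with every left multiplication: with
  respect to \<open>A\<close> and \<open>B\<close> Clifford numbers behave as scalars, and the equation becomes an identity between
  polynomials in the two paravectors \<open>p\<close> and \<open>s\<close>.

  Let \<open>Q(s) = s\<^sup>2 - s A + B\<close>, with inverse \<open>D(s)\<close>. The left side is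
  \<open>-4 D(s) (p - U + s - T) D(p) = -4 D(s) (p + s - A) D(p)\<close>. On the right side,
  \<open>D(s) - D(p) = D(s) (Q(p) - Q(s)) D(p)\<close>. The operator \<open>D(s)\<close> commutes with the conjugate \<open>s'\<close> of \<open>s\<close>, and
  \<open>D(p)\<close> with \<open>p\<close>, so these multiplications can be moved next to the difference \<open>Q(p) - Q(s)\<close>, and what
  remains is \<open>Qc_difference_Qpoly\<close>, that is
  \<open>(Q(p) - Q(s)) p - s' (Q(p) - Q(s)) = (p + s - A) (p\<^sup>2 - 2 s\<^sub>0 p + |s|\<^sup>2)\<close>.
  It holds because \<open>s + s' = 2 s\<^sub>0\<close> and \<open>s s' = |s|\<^sup>2\<close> are real, hence commute with \<open>p\<close>.

  Two inverses must exist for this. The Clifford number \<open>p\<^sup>2 - 2 s\<^sub>0 p + |s|\<^sup>2\<close> is itself a paravector, because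
  \<open>p\<^sup>2 = 2 p\<^sub>0 p - |p|\<^sup>2\<close>; it vanishes only for \<open>s \<in> [p]\<close>, and a nonzero paravector is invertible by its
  conjugate (\<open>Qpoly_inverse\<close>). For \<open>Q(s)\<close>, whose invertibility is not what the resolvent set
  provides, put \<open>P(T) = T\<^sup>2 - 2 s\<^sub>0 T + |s|\<^sup>2\<close>. Then \<open>Q(s) Q(s') = P(T) P(U)\<close> (\<open>S_char_factorization\<close>): both
  are \<open>(s - T) (s - U) (s' - T) (s' - U)\<close> if \<open>s\<close> is treated as a scalar. The grade involution of \<open>V\<^sub>5\<close>
  conjugates \<open>T\<close> to \<open>U\<close>, so \<open>P(U)\<close> is invertible along with \<open>P(T)\<close>, and therefore so is the factor \<open>Q(s)\<close>
  (\<open>Qc_inv_inverse\<close>).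
\<close>

section \<open>Inverses of paravectors\<close>

lemma sum_antisym_eq_diagonal:
  fixes f :: "'i::finite \<Rightarrow> 'i \<Rightarrow> 'a::real_vector"
  assumes "\<And>j k. j \<noteq> k \<Longrightarrow> f j k + f k j = 0"
  shows "(\<Sum>j\<in>UNIV. \<Sum>k\<in>UNIV. f j k) = (\<Sum>j\<in>UNIV. f j j)"
proof -
  have "2 *\<^sub>R (\<Sum>j\<in>UNIV. \<Sum>k\<in>UNIV. f j k)
      = (\<Sum>j\<in>UNIV. \<Sum>k\<in>UNIV. f j k) + (\<Sum>k\<in>UNIV. \<Sum>j\<in>UNIV. f j k)"
    by (subst (2) sum.swap) (simp add: scaleR_2)
  also have "\<dots> = (\<Sum>j\<in>UNIV. \<Sum>k\<in>UNIV. f j k + f k j)"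
    by (simp add: sum.distrib)
  also have "\<dots> = (\<Sum>j\<in>UNIV. \<Sum>k\<in>UNIV. if k = j then 2 *\<^sub>R f j j else 0)"
    using assms by (intro sum.cong refl) (auto simp: scaleR_2)
  also have "\<dots> = 2 *\<^sub>R (\<Sum>j\<in>UNIV. f j j)"
    by (simp add: scaleR_sum_right)
  finally show ?thesis by simp
qed

lemma vector_square:
  "(\<Sum>j\<in>UNIV. (x $ j) *\<^sub>R unit5 j) * (\<Sum>j\<in>UNIV. (x $ j) *\<^sub>R unit5 j) = - of_real ((norm x)\<^sup>2)"
proof -
  have "(\<Sum>j\<in>UNIV. (x $ j) *\<^sub>R unit5 j) * (\<Sum>j\<in>UNIV. (x $ j) *\<^sub>R unit5 j)
      = (\<Sum>j\<in>UNIV. \<Sum>k\<in>UNIV. (x $ j * x $ k) *\<^sub>R (unit5 j * unit5 k))"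
    by (simp add: sum_product mult.commute)
  also have "\<dots> = (\<Sum>j\<in>UNIV. (x $ j * x $ j) *\<^sub>R (unit5 j * unit5 j))"
  proof (rule sum_antisym_eq_diagonal)
    show "(x $ j * x $ k) *\<^sub>R (unit5 j * unit5 k) + (x $ k * x $ j) *\<^sub>R (unit5 k * unit5 j) = 0"
      if "j \<noteq> k" for j k
      using unit5_anticommute[OF that]
      by (simp add: mult.commute[of "x $ k"] flip: scaleR_add_right)
  qed
  also have "\<dots> = - of_real ((norm x)\<^sup>2)"
    by (simp add: unit5_square of_real_def sum_negf power2_norm_eq_inner inner_vec_def
        flip: scaleR_sum_left)
  finally show ?thesis .
qed

lemma paravec_pv_cnj: "paravec (pv_cnj x) = of_real (2 * fst x) - paravec x"
  unfolding mult_2 of_real_add by (simp add: paravec_def pv_cnj_def sum_negf)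

lemma paravec_plus_cnj: "paravec x + paravec (pv_cnj x) = of_real (2 * fst x)"
  unfolding paravec_pv_cnj by (rule add_diff_eq[THEN trans]) (rule add_diff_cancel_left')

lemma paravec_affine: "paravec (c * fst x + d, c *\<^sub>R snd x) = c *\<^sub>R paravec x + of_real d"
  by (simp add: paravec_def of_real_def scaleR_sum_right scaleR_right_distrib scaleR_left_distrib)

lemma paravec_mult_cnj: "paravec x * paravec (pv_cnj x) = of_real ((norm x)\<^sup>2)"
proof -
  define v where "v = (\<Sum>j\<in>UNIV. (snd x $ j) *\<^sub>R unit5 j)"
  have v: "v * v = - of_real ((norm (snd x))\<^sup>2)"
    unfolding v_def by (rule vector_square)
  have n: "(norm x)\<^sup>2 = (fst x)\<^sup>2 + (norm (snd x))\<^sup>2"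
    by (cases x) (simp add: norm_Pair)
  have "paravec x * paravec (pv_cnj x) = (of_real (fst x) + v) * (of_real (fst x) - v)"
    by (simp add: paravec_def pv_cnj_def v_def sum_negf)
  also have "\<dots> = of_real ((norm x)\<^sup>2)"
    unfolding n by (simp add: algebra_simps v of_real_def power2_eq_square)
  finally show ?thesis .
qed

lemma of_real_comm_clifford5: "of_real r * a = a * (of_real r :: clifford5)"
  by (simp add: of_real_def)

lemma paravec_cnj_commute: "paravec (pv_cnj x) * paravec x = paravec x * paravec (pv_cnj x)"
  using of_real_comm_clifford5[of "2 * fst x" "paravec x"]
  by (simp only: paravec_pv_cnj left_diff_distrib right_diff_distrib)

text \<open>
  A paravector is a root of \<open>X\<^sup>2 - 2 x\<^sub>0 X + |x|\<^sup>2\<close>, so a polynomial in it with real coefficients reduces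
  to a linear one, which is again a paravector.
\<close>

lemma paravec_square:
  "paravec x * paravec x = (2 * fst x) *\<^sub>R paravec x - of_real ((norm x)\<^sup>2)"
proof -
  have "paravec x * paravec x
      = paravec x * of_real (2 * fst x) - paravec x * paravec (pv_cnj x)"
    by (simp only: paravec_pv_cnj right_diff_distrib diff_diff_eq2) simp
  then show ?thesis
    by (simp only: paravec_mult_cnj scaleR_conv_of_real of_real_comm_clifford5[of _ "paravec x"])
qed

lemma cl_inv_unique:
  assumes "a * b = 1" "b * a = 1"
  shows "cl_inv a = b"
  unfolding cl_inv_def using assms
  by (intro the_equality) (auto, metis mult.assoc mult_1_left mult_1_right)

lemma cl_inv_paravec:
  assumes "x \<noteq> 0"
  shows "paravec x * cl_inv (paravec x) = 1"
proof -
  define b where "b = inverse ((norm x)\<^sup>2) *\<^sub>R paravec (pv_cnj x)"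
  have "paravec x * b = 1" "b * paravec x = 1"
    using assms unfolding b_def
    by (simp_all add: paravec_cnj_commute paravec_mult_cnj of_real_def del: of_real_power)
  then show ?thesis using cl_inv_unique by metis
qed

lemma Qpoly_eq_paravec:
  "Qpoly s p = paravec (2 * (fst p - fst s) * fst p + (norm s)\<^sup>2 - (norm p)\<^sup>2,
                        (2 * (fst p - fst s)) *\<^sub>R snd p)"
proof -
  have "Qpoly s p = (2 * (fst p - fst s)) *\<^sub>R paravec p + of_real ((norm s)\<^sup>2 - (norm p)\<^sup>2)"
    unfolding Qpoly_def power2_eq_square[of "paravec p"] paravec_square scaleR_conv_of_real[symmetric]
    by (simp add: algebra_simps del: of_real_power)
  also have "\<dots> = paravec (2 * (fst p - fst s) * fst p + ((norm s)\<^sup>2 - (norm p)\<^sup>2),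
                              (2 * (fst p - fst s)) *\<^sub>R snd p)"
    by (rule paravec_affine[symmetric])
  finally show ?thesis by (simp only: add_diff_eq)
qed

lemma pv_class_memI:
  assumes "fst s = fst p" "norm (snd s) = norm (snd p)"
  shows "s \<in> pv_class p"
proof (cases "snd p = 0")
  case True
  obtain i :: "real ^ 5" where "norm i = 1" using vector_choose_size[of 1] by auto
  then show ?thesis using assms True unfolding pv_class_def by (cases s) auto
next
  case False
  let ?i = "inverse (norm (snd p)) *\<^sub>R snd s"
  have "norm ?i = 1" "s = (fst p, norm (snd p) *\<^sub>R ?i)"
    using assms False by (auto simp: prod_eq_iff)
  then show ?thesis unfolding pv_class_def by blast
qed

text \<open>
  The vector part \<open>2 (p\<^sub>0 - s\<^sub>0) p\<close> vanishes only if \<open>p\<^sub>0 = s\<^sub>0\<close>, when the real part is the difference of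
  the squared moduli of the vector parts, or if \<open>p\<close> is real, when the real part is the squared distance of
  \<open>s\<close> and \<open>p\<close>. In both cases a zero real part puts \<open>s\<close> into \<open>[p]\<close>.
\<close>

lemma Qpoly_inverse:
  assumes "s \<notin> pv_class p"
  shows "Qpoly s p * cl_inv (Qpoly s p) = 1"
proof -
  have nrm: "(norm x)\<^sup>2 = (fst x)\<^sup>2 + (norm (snd x))\<^sup>2" for x :: R6
    by (cases x) (simp add: norm_Pair)
  have "(2 * (fst p - fst s) * fst p + (norm s)\<^sup>2 - (norm p)\<^sup>2, (2 * (fst p - fst s)) *\<^sub>R snd p) \<noteq> 0"
  proof
    assume "(2 * (fst p - fst s) * fst p + (norm s)\<^sup>2 - (norm p)\<^sup>2,
              (2 * (fst p - fst s)) *\<^sub>R snd p) = 0"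
    then have re: "2 * (fst p - fst s) * fst p + (norm s)\<^sup>2 - (norm p)\<^sup>2 = 0"
      and vec: "fst p = fst s \<or> snd p = 0"
      by (auto simp: zero_prod_def)
    have "fst p = fst s \<and> norm (snd s) = norm (snd p)"
    proof (cases "fst p = fst s")
      case True
      then show ?thesis using re by (simp add: nrm)
    next
      case False
      then have "snd p = 0" using vec by blast
      then have "(fst p - fst s)\<^sup>2 + (norm (snd s))\<^sup>2 = 0"
        using re unfolding nrm by (simp add: power2_eq_square algebra_simps)
      then show ?thesis using False by (simp add: sum_power2_eq_zero_iff)
    qed
    then show False using pv_class_memI assms by metis
  qed
  then show ?thesis unfolding Qpoly_eq_paravec by (rule cl_inv_paravec)
qed

section \<open>The algebra of operators\<close>

lemmas compose_distribs =
  bounded_bilinear.add_left[OF bounded_bilinear_blinfun_compose]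
  bounded_bilinear.add_right[OF bounded_bilinear_blinfun_compose]
  bounded_bilinear.diff_left[OF bounded_bilinear_blinfun_compose]
  bounded_bilinear.diff_right[OF bounded_bilinear_blinfun_compose]
  bounded_bilinear.minus_left[OF bounded_bilinear_blinfun_compose]
  bounded_bilinear.minus_right[OF bounded_bilinear_blinfun_compose]
  bounded_bilinear.scaleR_left[OF bounded_bilinear_blinfun_compose]
  bounded_bilinear.scaleR_right[OF bounded_bilinear_blinfun_compose]
  bounded_bilinear.sum_left[OF bounded_bilinear_blinfun_compose]
  bounded_bilinear.sum_right[OF bounded_bilinear_blinfun_compose]

lemma blinfun_compose_assoc: "(F o\<^sub>L G) o\<^sub>L H = F o\<^sub>L (G o\<^sub>L H)"
  by (rule blinfun_eqI) simp

lemma compose_id [simp]: "id_blinfun o\<^sub>L F = F" "F o\<^sub>L id_blinfun = F"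
  by (auto intro: blinfun_eqI)

lemma left_inverse_eq_right_inverse:
  assumes "G o\<^sub>L F = id_blinfun" "F o\<^sub>L H = id_blinfun"
  shows "G = H"
proof -
  have "G = G o\<^sub>L (F o\<^sub>L H)" by (simp only: assms(2) compose_id)
  also have "\<dots> = H" by (simp only: blinfun_compose_assoc[symmetric] assms(1) compose_id)
  finally show ?thesis .
qed

lemma lmul_add: "lmul (a + b) = lmul a + lmul b"
  by (rule blinfun_eqI)
     (simp add: lmul.rep_eq lact_def vec_eq_iff blade_prod_nth plus_clifford5.rep_eq
       blinfun.add_left algebra_simps sum.distrib)

lemma lmul_scaleR: "lmul (r *\<^sub>R a) = r *\<^sub>R lmul a"
  by (rule blinfun_eqI)
     (simp add: lmul.rep_eq lact_def vec_eq_iff blade_prod_nth scaleR_clifford5.rep_eq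
       blinfun.scaleR_left scaleR_sum_right mult_ac)

lemma lmul_diff: "lmul (a - b) = lmul a - lmul b"
  using lmul_add[of a "(-1) *\<^sub>R b"] by (simp only: lmul_scaleR) simp

lemma lmul_one: "lmul 1 = id_blinfun"
proof (rule blinfun_eqI, subst vec_eq_iff, intro allI)
  fix v :: "'a V5" and C
  have "lmul 1 v $ C = (\<Sum>A\<in>(UNIV :: 5 set set). if A = {} then v $ C else 0)"
    unfolding lmul.rep_eq lact_def blade_prod_nth
    by (rule sum.cong) (auto simp: one_clifford5.rep_eq axis_def)
  then show "lmul 1 v $ C = id_blinfun v $ C" by simp
qed

lemma lmul_of_real: "lmul (of_real r) = r *\<^sub>R id_blinfun"
  by (simp add: of_real_def lmul_scaleR lmul_one)

lemma comp_op_nth: "comp_op F v $ A = F (v $ A)"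
  by (simp add: comp_op.rep_eq)

lemma comp_op_uminus: "comp_op (- F) = - comp_op F"
  by (rule blinfun_eqI) (simp add: vec_eq_iff comp_op_nth blinfun.minus_left)

lemma comp_op_compose: "comp_op (F o\<^sub>L G) = comp_op F o\<^sub>L comp_op G"
  by (rule blinfun_eqI) (simp add: vec_eq_iff comp_op_nth)

lemma lmul_comp_op_commute: "lmul a o\<^sub>L comp_op F = comp_op F o\<^sub>L lmul a"
  by (rule blinfun_eqI)
     (simp add: vec_eq_iff comp_op_nth lmul.rep_eq lact_def blade_prod_nth
       blinfun.sum_right blinfun.scaleR_right)

lemma comp_op_right_linear: "comp_op F \<in> right_linear_ops"
  by (auto simp: right_linear_ops_def ract_def vec_eq_iff comp_op_nth blade_prod_nth
      blinfun.sum_right blinfun.scaleR_right)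

lemma right_linear_ops_add: "F \<in> right_linear_ops \<Longrightarrow> G \<in> right_linear_ops \<Longrightarrow> F + G \<in> right_linear_ops"
  by (auto simp: right_linear_ops_def blinfun.add_left ract_def vec_eq_iff blade_prod_nth
      algebra_simps sum.distrib)

lemma right_linear_ops_scaleR: "F \<in> right_linear_ops \<Longrightarrow> r *\<^sub>R F \<in> right_linear_ops"
  by (auto simp: right_linear_ops_def blinfun.scaleR_left ract_def vec_eq_iff blade_prod_nth
      scaleR_sum_right mult_ac)

lemma right_linear_ops_diff: "F \<in> right_linear_ops \<Longrightarrow> G \<in> right_linear_ops \<Longrightarrow> F - G \<in> right_linear_ops"
  using right_linear_ops_add[of F "(-1) *\<^sub>R G"] right_linear_ops_scaleR[of G "-1"] by simp

lemma right_linear_ops_compose: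
  "F \<in> right_linear_ops \<Longrightarrow> G \<in> right_linear_ops \<Longrightarrow> F o\<^sub>L G \<in> right_linear_ops"
  by (auto simp: right_linear_ops_def)

lemma right_linear_ops_sum:
  assumes "\<And>i. i \<in> I \<Longrightarrow> F i \<in> right_linear_ops"
  shows "sum F I \<in> right_linear_ops"
  using assms right_linear_ops_scaleR[OF comp_op_right_linear, of 0 0]
  by (induction I rule: infinite_finite_induct) (auto intro: right_linear_ops_add)

lemma para_op_right_linear: "para_op T0 Ts \<in> right_linear_ops"
  unfolding para_op_def
  by (intro right_linear_ops_add right_linear_ops_sum right_linear_ops_compose
      comp_op_right_linear lmul_right_linear)

text \<open>
  The inverse of a right-linear operator is automatically right-linear. Inverses may therefore be
  built from operators such as the grade involution, which is not right-linear.
\<close>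

lemma op_inv_unique:
  assumes F: "F \<in> right_linear_ops" and FG: "F o\<^sub>L G = id_blinfun" and GF: "G o\<^sub>L F = id_blinfun"
  shows "op_inv F = G"
  unfolding op_inv_def
proof (rule the_equality)
  have FG': "F (G v) = v" and GF': "G (F v) = v" for v
    using arg_cong[OF FG, of "\<lambda>H. blinfun_apply H v"] arg_cong[OF GF, of "\<lambda>H. blinfun_apply H v"]
    by simp_all
  have "G (ract v a) = ract (G v) a" for v a
  proof -
    have "F (ract (G v) a) = ract v a"
      using F by (simp add: right_linear_ops_def FG')
    then show ?thesis by (metis GF')
  qed
  then show "G \<in> right_linear_ops \<and> F o\<^sub>L G = id_blinfun \<and> G o\<^sub>L F = id_blinfun"
    using FG GF by (simp add: right_linear_ops_def)
  show "H = G" if "H \<in> right_linear_ops \<and> F o\<^sub>L H = id_blinfun \<and> H o\<^sub>L F = id_blinfun" for H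
    using that FG by (blast intro: left_inverse_eq_right_inverse)
qed

lemma inverse_commute:
  fixes F G H :: "'v::real_normed_vector \<Rightarrow>\<^sub>L 'v"
  assumes "F o\<^sub>L G = id_blinfun" "G o\<^sub>L F = id_blinfun" "F o\<^sub>L H = H o\<^sub>L F"
  shows "G o\<^sub>L H = H o\<^sub>L G"
proof -
  have "G o\<^sub>L H = G o\<^sub>L ((H o\<^sub>L F) o\<^sub>L G)"
    by (simp only: blinfun_compose_assoc assms(1) compose_id)
  also have "\<dots> = (G o\<^sub>L F) o\<^sub>L (H o\<^sub>L G)"
    by (simp only: blinfun_compose_assoc assms(3)[symmetric])
  finally show ?thesis by (simp only: assms(2) compose_id)
qed

section \<open>Operators with commuting components\<close>

lemma para_op_plus_cnj: "para_op T0 Ts + para_op T0 (\<lambda>j. - Ts j) = 2 *\<^sub>R comp_op T0"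
  by (simp add: para_op_def comp_op_uminus compose_distribs sum_negf scaleR_2)

text \<open>
  As for a vector: the units anticommute while the components commute, so the mixed terms cancel.
\<close>

lemma vector_op_square:
  assumes "\<And>j k. Ts j o\<^sub>L Ts k = Ts k o\<^sub>L Ts j"
  defines "X \<equiv> (\<Sum>j\<in>UNIV. lmul (unit5 j) o\<^sub>L comp_op (Ts j))"
  shows "X o\<^sub>L X = - (\<Sum>j\<in>UNIV. comp_op (Ts j o\<^sub>L Ts j))"
proof -
  have "X o\<^sub>L X = (\<Sum>j\<in>UNIV. \<Sum>k\<in>UNIV. lmul (unit5 j * unit5 k) o\<^sub>L comp_op (Ts j o\<^sub>L Ts k))"
  proof -
    have "(lmul (unit5 j) o\<^sub>L comp_op (Ts j)) o\<^sub>L (lmul (unit5 k) o\<^sub>L comp_op (Ts k))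
        = lmul (unit5 j * unit5 k) o\<^sub>L comp_op (Ts j o\<^sub>L Ts k)" for j k
    proof -
      have "(lmul (unit5 j) o\<^sub>L comp_op (Ts j)) o\<^sub>L (lmul (unit5 k) o\<^sub>L comp_op (Ts k))
          = lmul (unit5 j) o\<^sub>L ((comp_op (Ts j) o\<^sub>L lmul (unit5 k)) o\<^sub>L comp_op (Ts k))"
        by (simp only: blinfun_compose_assoc)
      then show ?thesis
        by (simp only: lmul_comp_op_commute[symmetric] blinfun_compose_assoc lmul_mult comp_op_compose)
    qed
    then show ?thesis
      unfolding X_def compose_distribs by (subst sum.swap) simp
  qed
  also have "\<dots> = (\<Sum>j\<in>UNIV. lmul (unit5 j * unit5 j) o\<^sub>L comp_op (Ts j o\<^sub>L Ts j))"
  proof (rule sum_antisym_eq_diagonal)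
    fix j k :: 5 assume "j \<noteq> k"
    then have "lmul (unit5 j * unit5 k) + lmul (unit5 k * unit5 j) = (0 :: 'a op5)"
      using unit5_anticommute[of j k] lmul_of_real[of 0] by (simp flip: lmul_add)
    then show "(lmul (unit5 j * unit5 k) o\<^sub>L comp_op (Ts j o\<^sub>L Ts k))
        + (lmul (unit5 k * unit5 j) o\<^sub>L comp_op (Ts k o\<^sub>L Ts j)) = 0"
      by (simp add: assms(1)[of k j] flip: compose_distribs(1))
  qed
  also have "\<dots> = - (\<Sum>j\<in>UNIV. comp_op (Ts j o\<^sub>L Ts j))"
  proof -
    have "lmul (-1) = - (id_blinfun :: 'a op5)"
      using lmul_of_real[of "-1", where 'a = 'a] by simp
    then show ?thesis by (simp add: unit5_square compose_distribs sum_negf)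
  qed
  finally show ?thesis .
qed

lemma para_op_cnj_compose:
  assumes "\<And>j. T0 o\<^sub>L Ts j = Ts j o\<^sub>L T0" and "\<And>j k. Ts j o\<^sub>L Ts k = Ts k o\<^sub>L Ts j"
  shows "para_op T0 Ts o\<^sub>L para_op T0 (\<lambda>j. - Ts j)
      = comp_op (T0 o\<^sub>L T0) + (\<Sum>j\<in>UNIV. comp_op (Ts j o\<^sub>L Ts j))"
    and "para_op T0 (\<lambda>j. - Ts j) o\<^sub>L para_op T0 Ts
      = comp_op (T0 o\<^sub>L T0) + (\<Sum>j\<in>UNIV. comp_op (Ts j o\<^sub>L Ts j))"
proof -
  define X where "X = (\<Sum>j\<in>UNIV. lmul (unit5 j) o\<^sub>L comp_op (Ts j))"
  have XX: "X o\<^sub>L X = - (\<Sum>j\<in>UNIV. comp_op (Ts j o\<^sub>L Ts j))"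
    unfolding X_def by (rule vector_op_square) (rule assms)
  have "lmul (unit5 j) o\<^sub>L comp_op (Ts j) o\<^sub>L comp_op T0
      = comp_op T0 o\<^sub>L (lmul (unit5 j) o\<^sub>L comp_op (Ts j))" for j
  proof -
    have "lmul (unit5 j) o\<^sub>L comp_op (Ts j) o\<^sub>L comp_op T0
        = lmul (unit5 j) o\<^sub>L (comp_op T0 o\<^sub>L comp_op (Ts j))"
      by (simp only: blinfun_compose_assoc flip: assms(1) comp_op_compose)
    then show ?thesis
      by (simp only: lmul_comp_op_commute[of _ T0] flip: blinfun_compose_assoc)
  qed
  then have 0: "X o\<^sub>L comp_op T0 = comp_op T0 o\<^sub>L X"
    by (simp add: X_def compose_distribs)
  have T: "para_op T0 Ts = comp_op T0 + X" "para_op T0 (\<lambda>j. - Ts j) = comp_op T0 - X"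
    by (simp_all add: para_op_def X_def comp_op_uminus compose_distribs sum_negf)
  show "para_op T0 Ts o\<^sub>L para_op T0 (\<lambda>j. - Ts j)
      = comp_op (T0 o\<^sub>L T0) + (\<Sum>j\<in>UNIV. comp_op (Ts j o\<^sub>L Ts j))"
    and "para_op T0 (\<lambda>j. - Ts j) o\<^sub>L para_op T0 Ts
      = comp_op (T0 o\<^sub>L T0) + (\<Sum>j\<in>UNIV. comp_op (Ts j o\<^sub>L Ts j))"
    by (simp_all add: T compose_distribs 0 XX comp_op_compose)
qed

text \<open>
  The main involution of the Clifford algebra, extended to \<open>V\<^sub>5\<close>. Conjugation by it
  fixes the operators that act coefficientwise and changes the sign of every unit.
\<close>

lift_definition grade_inv :: "'v::real_normed_vector op5" is
  "\<lambda>v. \<chi> A. (-1) ^ card A *\<^sub>R (v $ A)"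
  by (rule bounded_linear_vecI) (simp add: bounded_linear_const_scaleR bounded_linear_vec_nth)

lemma grade_inv_nth: "grade_inv v $ A = (-1) ^ card A *\<^sub>R (v $ A)"
  by (simp add: grade_inv.rep_eq)

lemma grade_inv_involution: "grade_inv o\<^sub>L grade_inv = id_blinfun"
  by (rule blinfun_eqI) (simp add: vec_eq_iff grade_inv_nth flip: power_mult_distrib)

lemma lmul_unit5_nth:
  "lmul (unit5 j) v $ C = blade_sign {j} (sym_diff {j} C) *\<^sub>R (v $ sym_diff {j} C)"
proof -
  have "lmul (unit5 j) v $ C
      = (\<Sum>A\<in>UNIV. if A = {j} then blade_sign A (sym_diff A C) *\<^sub>R (v $ sym_diff A C) else 0)"
    unfolding lmul.rep_eq lact_def blade_prod_nth unit5_def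
    by (rule sum.cong) (auto simp: Clifford5_inverse axis_def)
  then show ?thesis by simp
qed

lemma minus_one_power_card_flip: "(-1) ^ card (sym_diff {j} C) = - ((-1 :: real) ^ card (C :: 5 set))"
proof (cases "j \<in> C")
  case True
  then have "sym_diff {j} C = C - {j}" by auto
  moreover have "card C = Suc (card (C - {j}))"
    by (rule card.remove) (use True in simp_all)
  ultimately show ?thesis by simp
next
  case False
  then have "sym_diff {j} C = insert j C" by auto
  then show ?thesis using False by simp
qed

lemma grade_inv_para_op:
  "grade_inv o\<^sub>L para_op T0 Ts = para_op T0 (\<lambda>j. - Ts j) o\<^sub>L grade_inv"
proof -
  have c: "grade_inv o\<^sub>L comp_op F = comp_op F o\<^sub>L grade_inv" for F :: "'a \<Rightarrow>\<^sub>L 'a"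
    by (rule blinfun_eqI) (simp add: vec_eq_iff comp_op_nth grade_inv_nth blinfun.scaleR_right)
  have l: "grade_inv o\<^sub>L lmul (unit5 j) = - (lmul (unit5 j) o\<^sub>L (grade_inv :: 'a op5))" for j
    by (rule blinfun_eqI)
       (simp add: vec_eq_iff grade_inv_nth lmul_unit5_nth blinfun.minus_left
         minus_one_power_card_flip mult.commute del: Diff_insert_absorb insert_Diff_single)
  have "grade_inv o\<^sub>L (lmul (unit5 j) o\<^sub>L comp_op F) = - (lmul (unit5 j) o\<^sub>L comp_op F o\<^sub>L grade_inv)"
    for j and F :: "'a \<Rightarrow>\<^sub>L 'a"
    by (simp only: c l compose_distribs flip: blinfun_compose_assoc) (simp only: c blinfun_compose_assoc)
  then show ?thesis
    by (simp add: para_op_def compose_distribs comp_op_uminus c)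
qed

section \<open>Invertibility of the commutative pseudo-resolvent\<close>

text \<open>
  \<open>S_char s T\<close> is the operator whose invertibility defines the S-spectrum, \<open>Qc s T\<close> the one that is
  inverted in \<open>Qc_inv s T\<close>.
\<close>

definition S_char :: "R6 \<Rightarrow> 'v::real_normed_vector op5 \<Rightarrow> 'v op5" where
  "S_char s T = (T o\<^sub>L T) - (2 * fst s) *\<^sub>R T + (norm s)\<^sup>2 *\<^sub>R id_blinfun"

definition Qc :: "R6 \<Rightarrow> 'v::real_normed_vector op5 \<Rightarrow> 'v op5" where
  "Qc s T = lmul (paravec s ^ 2) - (lmul (paravec s) o\<^sub>L (T + op_cnj T)) + (T o\<^sub>L op_cnj T)"

text \<open>
  Here \<open>x\<close> and \<open>y\<close> stand for \<open>s\<close> and its conjugate, in either order, so that one computation shows that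
  the two factors \<open>Qc\<close> commute. As \<open>x + y\<close> and \<open>x y\<close> are real, all Clifford coefficients in the expanded
  product are real. It thus becomes a polynomial in \<open>T + U\<close> and \<open>T U\<close> with real coefficients, which is
  compared with the right side in the commuting operators \<open>T\<close> and \<open>U\<close>.
\<close>

lemma S_char_factorization:
  assumes TU: "U o\<^sub>L T = T o\<^sub>L U"
    and A: "\<And>a. lmul a o\<^sub>L (T + U) = (T + U) o\<^sub>L lmul a"
    and B: "\<And>a. lmul a o\<^sub>L (T o\<^sub>L U) = (T o\<^sub>L U) o\<^sub>L lmul a"
    and conj: "x + y = of_real \<sigma>" "x * y = of_real n" "y * x = of_real n"
  shows "(lmul (x ^ 2) - (lmul x o\<^sub>L (T + U)) + (T o\<^sub>L U)) o\<^sub>L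
         (lmul (y ^ 2) - (lmul y o\<^sub>L (T + U)) + (T o\<^sub>L U))
       = ((T o\<^sub>L T) - \<sigma> *\<^sub>R T + n *\<^sub>R id_blinfun) o\<^sub>L ((U o\<^sub>L U) - \<sigma> *\<^sub>R U + n *\<^sub>R id_blinfun)"
proof -
  define A' where "A' = T + U"
  define B' where "B' = T o\<^sub>L U"
  have TU': "U o\<^sub>L (T o\<^sub>L F) = T o\<^sub>L (U o\<^sub>L F)" for F
    by (simp only: TU flip: blinfun_compose_assoc)
  have AB: "B' o\<^sub>L A' = A' o\<^sub>L B'"
    by (simp add: A'_def B'_def compose_distribs TU TU' blinfun_compose_assoc)
  have a: "A' o\<^sub>L lmul c = lmul c o\<^sub>L A'" "B' o\<^sub>L lmul c = lmul c o\<^sub>L B'" for c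
    by (simp_all add: A'_def B'_def A B)
  have a': "A' o\<^sub>L (lmul c o\<^sub>L F) = lmul c o\<^sub>L (A' o\<^sub>L F)"
    "B' o\<^sub>L (lmul c o\<^sub>L F) = lmul c o\<^sub>L (B' o\<^sub>L F)" for c F
    by (simp_all only: a flip: blinfun_compose_assoc)
  have m: "lmul c o\<^sub>L (lmul d o\<^sub>L F) = lmul (c * d) o\<^sub>L F" for c d F
    by (simp add: lmul_mult blinfun_compose_assoc)
  have c2: "x ^ 2 * y = of_real n * x" "x * y ^ 2 = of_real n * y"
  proof -
    have "x ^ 2 * y = x * (x * y)" "x * y ^ 2 = (x * y) * y"
      by (simp_all only: power2_eq_square mult.assoc)
    then show "x ^ 2 * y = of_real n * x" "x * y ^ 2 = of_real n * y"
      by (simp_all only: conj of_real_comm_clifford5[of _ x])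
  qed
  have c1: "x ^ 2 * y ^ 2 = of_real (n * n)"
  proof -
    have "x ^ 2 * y ^ 2 = (x ^ 2 * y) * y" by (simp only: power2_eq_square mult.assoc)
    then show ?thesis by (simp only: c2 mult.assoc conj of_real_mult)
  qed
  have c3: "x ^ 2 + y ^ 2 = of_real (\<sigma> * \<sigma> - 2 * n)"
  proof -
    have "(x + y) * (x + y) = x ^ 2 + y ^ 2 + x * y + y * x"
      by (simp add: algebra_simps power2_eq_square)
    then have "x ^ 2 + y ^ 2 = of_real \<sigma> * of_real \<sigma> - of_real n - of_real n"
      by (simp add: conj)
    then show ?thesis by (simp only: of_real_diff of_real_mult mult_2 of_real_add diff_diff_eq)
  qed
  have "(lmul (x ^ 2) - (lmul x o\<^sub>L A') + B') o\<^sub>L (lmul (y ^ 2) - (lmul y o\<^sub>L A') + B')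
      = lmul (x ^ 2 * y ^ 2) - (lmul (x ^ 2 * y + x * y ^ 2) o\<^sub>L A') + (lmul (x ^ 2 + y ^ 2) o\<^sub>L B')
        + (lmul (x * y) o\<^sub>L (A' o\<^sub>L A')) - (lmul (x + y) o\<^sub>L (A' o\<^sub>L B')) + (B' o\<^sub>L B')"
    by (simp add: compose_distribs blinfun_compose_assoc a a' m AB lmul_add lmul_mult[symmetric])
  also have "x ^ 2 * y + x * y ^ 2 = of_real (n * \<sigma>)"
    by (simp add: c2 conj flip: distrib_left)
  also have "lmul (x ^ 2 * y ^ 2) - (lmul (of_real (n * \<sigma>)) o\<^sub>L A') + (lmul (x ^ 2 + y ^ 2) o\<^sub>L B')
        + (lmul (x * y) o\<^sub>L (A' o\<^sub>L A')) - (lmul (x + y) o\<^sub>L (A' o\<^sub>L B')) + (B' o\<^sub>L B')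
      = (n * n) *\<^sub>R id_blinfun - (n * \<sigma>) *\<^sub>R A' + (\<sigma> * \<sigma> - 2 * n) *\<^sub>R B'
        + n *\<^sub>R (A' o\<^sub>L A') - \<sigma> *\<^sub>R (A' o\<^sub>L B') + (B' o\<^sub>L B')"
    by (simp only: c1 c3 conj lmul_of_real compose_distribs compose_id)
  also have "\<dots> = ((T o\<^sub>L T) - \<sigma> *\<^sub>R T + n *\<^sub>R id_blinfun) o\<^sub>L ((U o\<^sub>L U) - \<sigma> *\<^sub>R U + n *\<^sub>R id_blinfun)"
    by (simp add: A'_def B'_def compose_distribs TU TU' blinfun_compose_assoc algebra_simps
        scaleR_2 scaleR_left_commute flip: scaleR_scaleR)
  finally show ?thesis by (simp only: A'_def B'_def)
qed

lemma inverse_of_commuting_factor: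
  fixes P Q R H :: "'v::real_normed_vector \<Rightarrow>\<^sub>L 'v"
  assumes "P o\<^sub>L Q = R" "Q o\<^sub>L P = R" "R o\<^sub>L H = id_blinfun" "H o\<^sub>L R = id_blinfun"
  shows "P o\<^sub>L (Q o\<^sub>L H) = id_blinfun" "(Q o\<^sub>L H) o\<^sub>L P = id_blinfun"
proof -
  show 1: "P o\<^sub>L (Q o\<^sub>L H) = id_blinfun"
    by (simp only: blinfun_compose_assoc[symmetric] assms)
  have 2: "(H o\<^sub>L Q) o\<^sub>L P = id_blinfun"
    by (simp only: blinfun_compose_assoc assms)
  have "H o\<^sub>L Q = Q o\<^sub>L H" using 2 1 by (rule left_inverse_eq_right_inverse)
  then show "(Q o\<^sub>L H) o\<^sub>L P = id_blinfun" using 2 by simp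
qed

lemma BC01_cnj:
  assumes "T \<in> BC01"
  shows BC01_cnj_commute: "op_cnj T o\<^sub>L T = T o\<^sub>L op_cnj T"
    and BC01_lmul_plus_cnj: "lmul a o\<^sub>L (T + op_cnj T) = (T + op_cnj T) o\<^sub>L lmul a"
    and BC01_lmul_compose_cnj: "lmul a o\<^sub>L (T o\<^sub>L op_cnj T) = (T o\<^sub>L op_cnj T) o\<^sub>L lmul a"
    and BC01_cnj_cnj: "op_cnj (op_cnj T) = T"
    and BC01_right_linear: "T \<in> right_linear_ops" "op_cnj T \<in> right_linear_ops"
    and BC01_grade_inv: "grade_inv o\<^sub>L T = op_cnj T o\<^sub>L grade_inv"
proof -
  obtain T0 Ts where T: "T = para_op T0 Ts"
    and comm: "\<And>j. T0 o\<^sub>L Ts j = Ts j o\<^sub>L T0" "\<And>j k. Ts j o\<^sub>L Ts k = Ts k o\<^sub>L Ts j"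
    using assms unfolding BC01_def by blast
  have U: "op_cnj T = para_op T0 (\<lambda>j. - Ts j)"
    unfolding T by (rule op_cnj_para_op)
  note prods = para_op_cnj_compose[OF comm]
  show "op_cnj T o\<^sub>L T = T o\<^sub>L op_cnj T"
    unfolding U unfolding T prods by (rule refl)
  show "lmul a o\<^sub>L (T + op_cnj T) = (T + op_cnj T) o\<^sub>L lmul a"
    unfolding U unfolding T para_op_plus_cnj by (simp only: compose_distribs lmul_comp_op_commute)
  show "lmul a o\<^sub>L (T o\<^sub>L op_cnj T) = (T o\<^sub>L op_cnj T) o\<^sub>L lmul a"
    unfolding U unfolding T prods by (simp only: compose_distribs lmul_comp_op_commute)
  show "op_cnj (op_cnj T) = T"
    unfolding U op_cnj_para_op by (simp add: T)
  show "T \<in> right_linear_ops" "op_cnj T \<in> right_linear_ops"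
    unfolding U unfolding T by (rule para_op_right_linear)+
  show "grade_inv o\<^sub>L T = op_cnj T o\<^sub>L grade_inv"
    unfolding U unfolding T by (rule grade_inv_para_op)
qed

lemma S_char_cnj:
  assumes "T \<in> BC01"
  shows "S_char s (op_cnj T) = grade_inv o\<^sub>L (S_char s T o\<^sub>L grade_inv)"
proof -
  let ?J = "grade_inv :: 'a op5" and ?U = "op_cnj T"
  note J = BC01_grade_inv[OF assms] grade_inv_involution
  have 1: "?J o\<^sub>L (T o\<^sub>L ?J) = ?U"
    by (simp only: J blinfun_compose_assoc[symmetric]) (simp only: J blinfun_compose_assoc compose_id)
  have 2: "?J o\<^sub>L (T o\<^sub>L (T o\<^sub>L ?J)) = ?U o\<^sub>L ?U"
    by (simp only: 1 J(1) blinfun_compose_assoc[symmetric]) (simp only: 1 blinfun_compose_assoc)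
  show ?thesis
    by (simp only: S_char_def compose_distribs compose_id blinfun_compose_assoc 1 2 J(2))
qed

text \<open>
  This is the inclusion between the two descriptions of the S-spectrum that makes the S-resolvent
  operators well defined: a factor of an invertible product of commuting factors is invertible.
\<close>

lemma Qc_inv_inverse:
  assumes T: "T \<in> BC01" and "s \<in> S_resolvent_set T"
  shows "Qc s T o\<^sub>L Qc_inv s T = id_blinfun"
    and "Qc_inv s T o\<^sub>L Qc s T = id_blinfun"
proof -
  let ?J = "grade_inv :: 'a op5" and ?U = "op_cnj T" and ?P = "S_char s T"
  let ?R = "?P o\<^sub>L S_char s ?U"
  obtain G where G: "?P o\<^sub>L G = id_blinfun" "G o\<^sub>L ?P = id_blinfun"
    using assms(2) unfolding S_resolvent_set_def S_spectrum_def op_invertible_def S_char_def by auto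
  have G': "?P o\<^sub>L (G o\<^sub>L F) = F" "G o\<^sub>L (?P o\<^sub>L F) = F" for F :: "'a op5"
    by (simp_all only: G compose_id flip: blinfun_compose_assoc)
  have J': "?J o\<^sub>L (?J o\<^sub>L F) = F" for F :: "'a op5"
    by (simp only: grade_inv_involution compose_id flip: blinfun_compose_assoc)
  \<comment> \<open>\<open>?J o\<^sub>L (G o\<^sub>L ?J)\<close> is the inverse of \<open>S_char s ?U\<close>, and \<open>?H\<close> that of the product.\<close>
  let ?H = "?J o\<^sub>L (G o\<^sub>L (?J o\<^sub>L G))"
  have H: "?R o\<^sub>L ?H = id_blinfun" "?H o\<^sub>L ?R = id_blinfun"
    by (simp_all only: S_char_cnj[OF T] blinfun_compose_assoc J' G' G grade_inv_involution)
  have prod: "paravec s * paravec (pv_cnj s) = of_real ((norm s)\<^sup>2)"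
    "paravec (pv_cnj s) * paravec s = of_real ((norm s)\<^sup>2)"
    by (simp_all only: paravec_cnj_commute paravec_mult_cnj)
  note fact = S_char_factorization[OF BC01_cnj_commute[OF T] BC01_lmul_plus_cnj[OF T]
      BC01_lmul_compose_cnj[OF T]]
  have "Qc s T o\<^sub>L Qc (pv_cnj s) T = ?R"
    unfolding Qc_def S_char_def by (rule fact[OF paravec_plus_cnj prod])
  moreover have "Qc (pv_cnj s) T o\<^sub>L Qc s T = ?R"
    unfolding Qc_def S_char_def
    by (rule fact[OF _ prod(2,1)]) (subst add.commute, rule paravec_plus_cnj)
  ultimately have inv: "Qc s T o\<^sub>L (Qc (pv_cnj s) T o\<^sub>L ?H) = id_blinfun"
    "(Qc (pv_cnj s) T o\<^sub>L ?H) o\<^sub>L Qc s T = id_blinfun"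
    using H by (rule inverse_of_commuting_factor)+
  have "Qc s T \<in> right_linear_ops"
    unfolding Qc_def
    by (intro right_linear_ops_add right_linear_ops_diff right_linear_ops_compose
        lmul_right_linear BC01_right_linear[OF T])
  then have "Qc_inv s T = Qc (pv_cnj s) T o\<^sub>L ?H"
    unfolding Qc_inv_def Qc_def[symmetric] using inv by (rule op_inv_unique)
  then show "Qc s T o\<^sub>L Qc_inv s T = id_blinfun"
    and "Qc_inv s T o\<^sub>L Qc s T = id_blinfun"
    using inv by simp_all
qed

lemma Qc_inv_lmul_commute:
  assumes T: "T \<in> BC01" and s: "s \<in> S_resolvent_set T"
    and c: "paravec s * c = c * paravec s"
  shows "Qc_inv s T o\<^sub>L lmul c = lmul c o\<^sub>L Qc_inv s T"
proof (rule inverse_commute[OF Qc_inv_inverse[OF T s]])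
  have c2: "paravec s ^ 2 * c = c * paravec s ^ 2"
    using c by (metis power2_eq_square mult.assoc)
  have A: "(lmul (paravec s) o\<^sub>L (T + op_cnj T)) o\<^sub>L lmul c
      = lmul c o\<^sub>L (lmul (paravec s) o\<^sub>L (T + op_cnj T))"
  proof -
    have "(lmul (paravec s) o\<^sub>L (T + op_cnj T)) o\<^sub>L lmul c
        = (lmul (paravec s * c)) o\<^sub>L (T + op_cnj T)"
      by (simp only: blinfun_compose_assoc BC01_lmul_plus_cnj[OF T, symmetric] lmul_mult)
    then show ?thesis by (simp only: c lmul_mult blinfun_compose_assoc)
  qed
  show "Qc s T o\<^sub>L lmul c = lmul c o\<^sub>L Qc s T"
    unfolding Qc_def compose_distribs(1,2,3,4) lmul_mult[symmetric] c2
    using A BC01_lmul_compose_cnj[OF T, of c]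
    by (simp only: compose_distribs(1,2) lmul_mult[symmetric])
qed

section \<open>The resolvent equation\<close>

text \<open>
  As \<open>T U\<close> cancels in \<open>\<Delta>\<close>, both sides have the form \<open>a - b A\<close> with Clifford numbers \<open>a\<close>, \<open>b\<close> and
  \<open>A = T + U\<close>, where \<open>U\<close> is the conjugate of \<open>T\<close>; the two coefficients are compared separately.
\<close>

lemma Qc_difference_Qpoly:
  fixes p s :: R6
  assumes T: "T \<in> BC01"
  defines "\<Delta> \<equiv> Qc p T - Qc s T"
  shows "(\<Delta> o\<^sub>L lmul (paravec p)) - (lmul (paravec (pv_cnj s)) o\<^sub>L \<Delta>)
      = (lmul (paravec p + paravec s) - (T + op_cnj T)) o\<^sub>L lmul (Qpoly s p)"
proof -
  define A where "A = T + op_cnj T"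
  define P where "P = paravec p"
  define S where "S = paravec s"
  define S' where "S' = paravec (pv_cnj s)"
  have A: "A o\<^sub>L lmul c = lmul c o\<^sub>L A" for c
    unfolding A_def by (rule BC01_lmul_plus_cnj[OF T, symmetric])
  have \<sigma>: "of_real (2 * fst s) = S + S'"
    by (simp only: S_def S'_def paravec_plus_cnj)
  have n: "of_real ((norm s)\<^sup>2) = S' * S" "S * S' = S' * S"
    by (simp_all only: S_def S'_def paravec_cnj_commute paravec_mult_cnj)
  \<comment> \<open>The real numbers \<open>S' * S\<close> and \<open>S + S'\<close> commute with \<open>P\<close>, although \<open>S\<close> itself need not.\<close>
  have n_comm: "S' * (S * P) = P * (S' * S)"
    using of_real_comm_clifford5[of "(norm s)\<^sup>2" P] unfolding n by (simp only: mult.assoc)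
  have \<sigma>_comm: "S * P + S' * P = P * S + P * S'"
    using of_real_comm_clifford5[of "2 * fst s" P] unfolding \<sigma> by (simp only: distrib_left distrib_right)
  have W: "Qpoly s p = P * P - (S + S') * P + S' * S"
    unfolding Qpoly_def \<sigma> n P_def[symmetric] power2_eq_square[of P] ..
  have \<Delta>: "\<Delta> = lmul (P * P - S * S) - (lmul (P - S) o\<^sub>L A)"
    by (simp add: \<Delta>_def Qc_def A_def[symmetric] P_def S_def lmul_diff compose_distribs(3) power2_eq_square)
  have const: "(P * P - S * S) * P - S' * (P * P - S * S) = (P + S) * Qpoly s p"
  proof -
    have "P * S * P + P * S' * P = S * P * P + S' * P * P"
      using arg_cong[OF \<sigma>_comm, of "\<lambda>x. x * P"] by (simp only: distrib_right)
    moreover have "P * S' * S = S * S' * P"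
      unfolding n(2) using n_comm by (simp only: mult.assoc)
    moreover have "S * S' * S = S' * S * S"
      by (simp only: n(2))
    ultimately show ?thesis
      unfolding W by (simp add: algebra_simps)
  qed
  have lin: "(P - S) * P - S' * (P - S) = Qpoly s p"
    unfolding W by (simp add: algebra_simps)
  have "(\<Delta> o\<^sub>L lmul P) - (lmul S' o\<^sub>L \<Delta>)
      = lmul ((P * P - S * S) * P - S' * (P * P - S * S)) - (lmul ((P - S) * P - S' * (P - S)) o\<^sub>L A)"
    by (simp only: \<Delta> compose_distribs(3,4) blinfun_compose_assoc A lmul_mult lmul_diff[of "_ * _"])
      (simp add: algebra_simps)
  also have "\<dots> = (lmul (P + S) - A) o\<^sub>L lmul (Qpoly s p)"
    by (simp only: const lin lmul_mult compose_distribs(3) A)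
  finally show ?thesis by (simp only: P_def S_def S'_def A_def)
qed

theorem theorem3p9:
  fixes T :: "('v::banach) op5" and p s :: R6
  assumes "T \<in> BC01"
    and "p \<in> S_resolvent_set T" and "s \<in> S_resolvent_set T"
    and "s \<notin> pv_class p"
  shows "(S_DR_inv s T o\<^sub>L S_L_inv p T) + (S_R_inv s (op_cnj T) o\<^sub>L S_DL_inv p T) =
    (((S_DL_inv s T - S_DL_inv p T) o\<^sub>L lmul (paravec p))
      - (lmul (paravec (pv_cnj s)) o\<^sub>L (S_DL_inv s T - S_DL_inv p T)))
    o\<^sub>L lmul (cl_inv (Qpoly s p))"
proof -
  define U where "U = op_cnj T"
  define Ds where "Ds = Qc_inv s T"
  define Dp where "Dp = Qc_inv p T"
  define \<Delta> where "\<Delta> = Qc p T - Qc s T"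
  let ?P = "lmul (paravec p) :: 'v op5" and ?S = "lmul (paravec s) :: 'v op5"
  let ?S' = "lmul (paravec (pv_cnj s)) :: 'v op5"
  let ?W = "Qpoly s p"
  note T = assms(1)
  have inv_s: "Ds o\<^sub>L Qc s T = id_blinfun" and inv_p: "Qc p T o\<^sub>L Dp = id_blinfun"
    unfolding Ds_def Dp_def U_def by (rule Qc_inv_inverse assms)+
  have Qc_cnj: "Qc_inv s (op_cnj T) = Ds"
    unfolding Qc_inv_def Ds_def BC01_cnj_cnj[OF T]
    by (simp only: BC01_cnj_commute[OF T] add.commute)
  have DpP: "Dp o\<^sub>L ?P = ?P o\<^sub>L Dp"
    unfolding Dp_def by (rule Qc_inv_lmul_commute[OF T assms(2) refl])
  have DpW: "Dp o\<^sub>L lmul ?W = lmul ?W o\<^sub>L Dp"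
    unfolding Dp_def
  proof (rule Qc_inv_lmul_commute[OF T assms(2)])
    show "paravec p * ?W = ?W * paravec p"
      unfolding Qpoly_def power2_eq_square of_real_def by (simp add: algebra_simps)
  qed
  have DsS': "Ds o\<^sub>L ?S' = ?S' o\<^sub>L Ds"
    unfolding Ds_def by (rule Qc_inv_lmul_commute[OF T assms(3) paravec_cnj_commute[symmetric]])

  have diff: "Ds - Dp = Ds o\<^sub>L (\<Delta> o\<^sub>L Dp)"
  proof -
    have "Ds o\<^sub>L (\<Delta> o\<^sub>L Dp) = (Ds o\<^sub>L (Qc p T o\<^sub>L Dp)) - ((Ds o\<^sub>L Qc s T) o\<^sub>L Dp)"
      by (simp only: \<Delta>_def compose_distribs(3,4) blinfun_compose_assoc)
    then show ?thesis by (simp only: inv_s inv_p compose_id)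
  qed
  have "((Ds - Dp) o\<^sub>L ?P) - (?S' o\<^sub>L (Ds - Dp))
      = Ds o\<^sub>L (((\<Delta> o\<^sub>L ?P) - (?S' o\<^sub>L \<Delta>)) o\<^sub>L Dp)"
  proof -
    have "(Ds - Dp) o\<^sub>L ?P = Ds o\<^sub>L ((\<Delta> o\<^sub>L ?P) o\<^sub>L Dp)"
      unfolding diff by (simp only: blinfun_compose_assoc DpP)
    moreover have "?S' o\<^sub>L (Ds - Dp) = Ds o\<^sub>L ((?S' o\<^sub>L \<Delta>) o\<^sub>L Dp)"
      unfolding diff by (simp only: DsS'[symmetric] flip: blinfun_compose_assoc)
    ultimately show ?thesis by (simp only: compose_distribs(3,4))
  qed
  also have "\<dots> = Ds o\<^sub>L ((lmul (paravec p + paravec s) - (T + U)) o\<^sub>L (Dp o\<^sub>L lmul ?W))"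
    unfolding \<Delta>_def U_def Qc_difference_Qpoly[OF T] DpW by (simp only: blinfun_compose_assoc)
  finally have bracket: "((Ds - Dp) o\<^sub>L ?P) - (?S' o\<^sub>L (Ds - Dp))
      = (Ds o\<^sub>L ((lmul (paravec p + paravec s) - (T + U)) o\<^sub>L Dp)) o\<^sub>L lmul ?W"
    by (simp only: blinfun_compose_assoc)
  have "lmul ?W o\<^sub>L lmul (cl_inv ?W) = (id_blinfun :: 'v op5)"
    using Qpoly_inverse[OF assms(4)] by (simp only: lmul_one flip: lmul_mult)
  then have rhs: "(((Ds - Dp) o\<^sub>L ?P) - (?S' o\<^sub>L (Ds - Dp))) o\<^sub>L lmul (cl_inv ?W)
      = Ds o\<^sub>L ((lmul (paravec p + paravec s) - (T + U)) o\<^sub>L Dp)"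
    unfolding bracket by (simp only: blinfun_compose_assoc compose_id)
  have lhs: "(Ds o\<^sub>L ((?P - U) o\<^sub>L Dp)) + ((Ds o\<^sub>L (?S - T)) o\<^sub>L Dp)
      = Ds o\<^sub>L ((lmul (paravec p + paravec s) - (T + U)) o\<^sub>L Dp)"
    by (simp only: compose_distribs(1-4) blinfun_compose_assoc lmul_add) (simp add: algebra_simps)
  have "(S_DR_inv s T o\<^sub>L S_L_inv p T) + (S_R_inv s (op_cnj T) o\<^sub>L S_DL_inv p T)
      = (-4) *\<^sub>R ((Ds o\<^sub>L ((?P - U) o\<^sub>L Dp)) + ((Ds o\<^sub>L (?S - T)) o\<^sub>L Dp))"
    unfolding S_DR_inv_def S_L_inv_def S_R_inv_def S_DL_inv_def Qc_cnj BC01_cnj_cnj[OF T]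
    by (simp only: Ds_def Dp_def U_def compose_distribs(7,8) scaleR_right_distrib)
  also have "\<dots> = (-4) *\<^sub>R ((((Ds - Dp) o\<^sub>L ?P) - (?S' o\<^sub>L (Ds - Dp))) o\<^sub>L lmul (cl_inv ?W))"
    by (simp only: lhs rhs)
  also have "\<dots> = (((S_DL_inv s T - S_DL_inv p T) o\<^sub>L ?P)
      - (?S' o\<^sub>L (S_DL_inv s T - S_DL_inv p T))) o\<^sub>L lmul (cl_inv ?W)"
    by (simp only: S_DL_inv_def Ds_def Dp_def compose_distribs(7,8) flip: scaleR_right_diff_distrib)
  finally show ?thesis .
qed

end
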